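(* Let $C\subset\mathbb{R}^n$ be a compact convex set, let $F:\mathbb{R}^n\to\mathbb{R}^n$ be monotone and continuous, and let $f:\mathbb{R}^n\to\mathbb{R}$ be a finite-valued convex function. Then $\bar x$ is a solution of (SMPEC) if and only if there exists $u\in\partial f(\bar x)$ and, for each $k\in\mathbb{N}$, there exist $\lambda_k\in\mathbb{R}_+$, $x_k\in\operatorname{dom}(\lambda_kg_D)$, $y_k\in C$, $w_k\in N_C(y_k)$, scalars $\mu_i^k\ge0$ and vectors $y_i^k\in Y(x_k)$, $i=1,\dots,n+1$, with $\sum_{i=1}^{n+1}\mu_i^k=1$, such that, as $k\to+\infty$, $$u+\lambda_k\sum_{i=1}^{n+1}\mu_i^kF(y_i^k)+w_k\to0,$$ $$x_k\to\bar x,\qquad y_k\to\bar x,$$ $$(\lambda_kg_D)(x_k)-\Big\langle\lambda_k\sum_{i=1}^{n+1}\mu_i^kF(y_i^k),\,x_k-\bar x\Big\rangle\to0,$$ $$\langle w_k,y_k-\bar x\rangle\to0.$$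
   Context: $F$ is monotone if $\langle F(y)-F(x),y-x\rangle\ge 0$ for all $x,y\in\mathbb{R}^n$. The variational inequality $VI(F,C)$ is: find $x\in C$ such that $\langle F(x),y-x\rangle\ge0$ for all $y\in C$; its solution set $S$ is assumed nonempty. The problem (SMPEC) is: minimize $f(x)$ subject to $x\in S$; a solution is a global minimizer of $f$ over $S$. The dual gap function is $g_D(x)=\sup_{y\in C}\langle F(y),x-y\rangle$, finite and convex on $\mathbb{R}^n$ since $C$ is compact, and $Y(x)=\{y\in C: g_D(x)=\langle F(y),x-y\rangle\}$. $\partial$ is the convex subdifferential, $N_C(y)=\{w:\langle w,x-y\rangle\le0\ \forall x\in C\}$ is the normal cone at $y\in C$, and $\operatorname{dom}\phi=\{x:\phi(x)<+\infty\}$.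
   Formalization: The point x̄ is assumed feasible, x̄∈S; without this the "if" part fails: n=1, C=[0,1], F=1, f(x)=-x, x̄=1, u=-1, λ_k=0, x_k=y_k=1, w_k=1 meets all conditions, but S={0}. *)

theory Defs
  imports "HOL-Analysis.Analysis"
begin

definition vi_monotone :: "('a::real_inner \<Rightarrow> 'a) \<Rightarrow> bool" where
  "vi_monotone F \<longleftrightarrow> (\<forall>x y. (F y - F x) \<bullet> (y - x) \<ge> 0)"

definition vi_solutions :: "('a::real_inner \<Rightarrow> 'a) \<Rightarrow> 'a set \<Rightarrow> 'a set" where
  "vi_solutions F C = {x \<in> C. \<forall>y\<in>C. F x \<bullet> (y - x) \<ge> 0}"

definition smpec_solution ::
    "('a::real_inner \<Rightarrow> real) \<Rightarrow> ('a \<Rightarrow> 'a) \<Rightarrow> 'a set \<Rightarrow> 'a \<Rightarrow> bool" where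
  "smpec_solution f F C x \<longleftrightarrow> is_arg_min f (\<lambda>z. z \<in> vi_solutions F C) x"

(* Extended-valued: the supremum over an arbitrary set C need not be finite.  On a nonempty
   compact C with F continuous, it is attained. *)
definition dual_gap :: "('a::real_inner \<Rightarrow> 'a) \<Rightarrow> 'a set \<Rightarrow> 'a \<Rightarrow> ereal" where
  "dual_gap F C x = (SUP y\<in>C. ereal (F y \<bullet> (x - y)))"

definition dual_gap_argmax :: "('a::real_inner \<Rightarrow> 'a) \<Rightarrow> 'a set \<Rightarrow> 'a \<Rightarrow> 'a set" where
  "dual_gap_argmax F C x = {y \<in> C. dual_gap F C x = ereal (F y \<bullet> (x - y))}"

definition effective_domain :: "('a \<Rightarrow> ereal) \<Rightarrow> 'a set" where
  "effective_domain \<phi> = {x. \<phi> x < \<infinity>}"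

definition subdifferential :: "('a::real_inner \<Rightarrow> real) \<Rightarrow> 'a \<Rightarrow> 'a set" where
  "subdifferential f x = {u. \<forall>y. f y \<ge> f x + u \<bullet> (y - x)}"

(* Meant for y in C only. *)
definition normal_cone :: "'a::real_inner set \<Rightarrow> 'a \<Rightarrow> 'a set" where
  "normal_cone C y = {w. \<forall>x\<in>C. w \<bullet> (x - y) \<le> 0}"

end

theory Submission
  imports Defs
begin

text \<open>
  By Minty's lemma the solution set \<open>S\<close> of the variational inequality consists of the points of
  \<open>C\<close> at which the convex dual gap function \<open>g\<close> is at most \<open>0\<close>
  (\<open>solution_iff_gap_nonpos\<close>). Hence the bilevel problem is a convex program with the single
  constraint \<open>g \<le> 0\<close> over \<open>C\<close>. Since \<open>g\<close> is nonnegative on \<open>C\<close>, no Slater point exists and an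
  exact multiplier may fail to exist; the sequential conditions replace it.

  Sufficiency (\<open>sequential_multipliers_imp_variational\<close>). The vectors \<open>\<Sum>\<^sub>i \<mu>\<^sub>i F y\<^sub>i\<close> are
  subgradients of \<open>g\<close> at \<open>x\<^sub>k\<close>, and \<open>w\<^sub>k\<close> is normal to \<open>C\<close> at \<open>y\<^sub>k\<close>. Evaluating the two
  corresponding inequalities at any \<open>z \<in> S\<close> bounds the pairing of both multipliers with
  \<open>z - xbar\<close> from above by the error terms. These tend to \<open>0\<close>, so \<open>u \<bullet> (z - xbar) \<ge> 0\<close>, and
  \<open>u\<close> being a subgradient of \<open>f\<close> finishes the argument.

  Necessity (\<open>sequential_multipliers\<close>). A separation argument
  (\<open>constrained_minimizer_multiplier\<close>) gives \<open>u \<in> \<partial>f(xbar)\<close> such that \<open>xbar\<close> minimizes the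
  linear function \<open>u\<close> over \<open>S\<close>. Now let \<open>z\<^sub>k\<close> minimize
  \<open>u \<bullet> z + (k + 1) g z + |z - xbar|\<^sup>2 / 2\<close> over \<open>C\<close>. The penalty forces every limit point of
  \<open>z\<^sub>k\<close> into \<open>S\<close>, and the quadratic term then forces it to be \<open>xbar\<close>. The first-order
  condition at \<open>z\<^sub>k\<close> reads \<open>u + c\<^sub>k v\<^sub>k + w\<^sub>k = xbar - z\<^sub>k\<close>, with \<open>c\<^sub>k\<close> the penalty weight,
  \<open>w\<^sub>k\<close> normal to \<open>C\<close> at \<open>z\<^sub>k\<close> and, by a Danskin argument
  (\<open>proximal_subgradient_in_convex_hull\<close>), \<open>v\<^sub>k\<close> in the convex hull of \<open>F\<close> over the maximizers
  that define \<open>g z\<^sub>k\<close>. Pairing this equation with \<open>z\<^sub>k - xbar\<close> shows that the two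
  complementarity errors, both of a definite sign, tend to \<open>0\<close>. So \<open>x\<^sub>k = y\<^sub>k = z\<^sub>k\<close> works, and
  Caratheodory's theorem writes \<open>v\<^sub>k\<close> with \<open>n + 1\<close> maximizers.
\<close>

section \<open>First-order condition for convex minimization over a convex set\<close>

lemma convex_strict_epigraph:
  fixes h :: "'a::real_vector \<Rightarrow> real"
  assumes "convex_on UNIV h"
  shows "convex {(x, t). h x < t}"
proof (rule convexI, clarsimp)
  fix x y :: 'a and s t u v :: real
  assume lt: "h x < s" "h y < t" and uv: "0 \<le> u" "0 \<le> v" "u + v = 1"
  have "h (u *\<^sub>R x + v *\<^sub>R y) \<le> u * h x + v * h y"
    using assms uv by (simp add: convex_on_def)
  also have "\<dots> < u * s + v * t"
  proof (cases "u = 0")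
    case True
    then show ?thesis using lt uv by simp
  next
    case False
    then have "u * h x < u * s" using lt uv by simp
    moreover have "v * h y \<le> v * t" using lt uv by (simp add: mult_left_mono)
    ultimately show ?thesis by linarith
  qed
  finally show "h (u *\<^sub>R x + v *\<^sub>R y) < u * s + v * t" .
qed

text \<open>
  This is the sum rule for \<open>h\<close> plus the indicator of \<open>D\<close>. Minimality says that the strict
  epigraph of \<open>h\<close> misses \<open>D \<times> {..h z}\<close>. A hyperplane separating the two sets is not vertical,
  because \<open>h\<close> is finite everywhere, and its slope is the required subgradient.
\<close>
theorem constrained_minimizer_multiplier:
  fixes h :: "'a::euclidean_space \<Rightarrow> real"
  assumes h: "convex_on UNIV h" and D: "convex D" "z \<in> D"
    and min: "\<And>x. x \<in> D \<Longrightarrow> h z \<le> h x"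
  obtains p where "p \<in> subdifferential h z" and "- p \<in> normal_cone D z"
proof -
  let ?A = "{(x, t). h x < t}" and ?B = "D \<times> {..h z}"
  have "(z, h z + 1) \<in> ?A" "(z, h z) \<in> ?B" using D by auto
  moreover have "?A \<inter> ?B = {}" using min by force
  moreover have "convex ?B" using D by (intro convex_Times) auto
  ultimately obtain ab c where ab: "ab \<noteq> 0" "\<And>xt. xt \<in> ?A \<Longrightarrow> ab \<bullet> xt \<le> c"
      "\<And>xt. xt \<in> ?B \<Longrightarrow> c \<le> ab \<bullet> xt"
    using separating_hyperplane_sets[OF convex_strict_epigraph[OF h], of ?B] by blast
  obtain a \<beta> where ab_eq: "ab = (a, \<beta>)" by (cases ab)
  have above: "a \<bullet> x + \<beta> * t \<le> c" if "h x < t" for x t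
    using ab(2)[of "(x, t)"] that by (simp add: ab_eq)
  have below: "c \<le> a \<bullet> x + \<beta> * h z" if "x \<in> D" for x
    using ab(3)[of "(x, h z)"] that by (simp add: ab_eq)
  have above': "a \<bullet> x + \<beta> * h x \<le> c" for x
  proof (rule tendsto_upperbound)
    show "((\<lambda>t. a \<bullet> x + \<beta> * t) \<longlongrightarrow> a \<bullet> x + \<beta> * h x) (at_right (h x))"
      by (intro tendsto_intros)
    show "eventually (\<lambda>t. a \<bullet> x + \<beta> * t \<le> c) (at_right (h x))"
      using above by (auto simp: eventually_at_right_less intro: eventually_mono[OF eventually_at_right_less])
  qed simp
  have \<beta>: "\<beta> < 0"
  proof -
    have "\<beta> \<le> 0" using above[of z "h z + 1"] below[OF D(2)] by (simp add: algebra_simps)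
    moreover have "\<beta> \<noteq> 0"
    proof
      \<comment> \<open>Otherwise the hyperplane is vertical; moving from \<open>z\<close> in direction \<open>a\<close>, where \<open>h\<close>
        is still finite, would cross it.\<close>
      assume "\<beta> = 0"
      then have "a \<bullet> (z + a) \<le> a \<bullet> z" using above'[of "z + a"] below[OF D(2)] by simp
      then have "a \<bullet> a \<le> 0" by (simp add: inner_add_right)
      then have "a = 0" using inner_ge_zero[of a] inner_eq_zero_iff[of a] by linarith
      then show False using ab(1) \<open>\<beta> = 0\<close> by (simp add: ab_eq zero_prod_def)
    qed
    ultimately show ?thesis by simp
  qed
  define p where "p = (1 / - \<beta>) *\<^sub>R a"
  have a: "a = (- \<beta>) *\<^sub>R p" using \<beta> by (simp add: p_def)
  show thesis
  proof
    show "p \<in> subdifferential h z"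
      unfolding subdifferential_def
    proof clarsimp
      fix x
      have "a \<bullet> x + \<beta> * h x \<le> a \<bullet> z + \<beta> * h z" using above'[of x] below[OF D(2)] by simp
      then have "(- \<beta>) * (h z + p \<bullet> (x - z)) \<le> (- \<beta>) * h x"
        by (simp add: a algebra_simps)
      then show "h z + p \<bullet> (x - z) \<le> h x" using \<beta> by (simp add: mult_le_cancel_left)
    qed
    show "- p \<in> normal_cone D z"
      unfolding normal_cone_def
    proof clarsimp
      fix x assume "x \<in> D"
      then have "a \<bullet> z \<le> a \<bullet> x" using above'[of z] below[of x] by simp
      then have "\<beta> * (p \<bullet> (x - z)) \<le> 0" by (simp add: a algebra_simps)
      then show "0 \<le> p \<bullet> (x - z)" using \<beta> by (simp add: mult_le_0_iff)
    qed
  qed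
qed

lemma convex_on_norm_diff_squared:
  fixes a :: "'a::real_inner"
  shows "convex_on UNIV (\<lambda>x. (norm (x - a))\<^sup>2)"
proof (rule convex_onI)
  fix t :: real and x y :: 'a
  assume t: "0 < t" "t < 1"
  have "(1 - t) * (norm (x - a))\<^sup>2 + t * (norm (y - a))\<^sup>2
      - (norm (((1 - t) *\<^sub>R x + t *\<^sub>R y) - a))\<^sup>2 = t * (1 - t) * (norm (x - y))\<^sup>2"
    by (simp add: power2_norm_eq_inner algebra_simps inner_commute)
  moreover have "\<dots> \<ge> 0" using t by simp
  ultimately show "(norm (((1 - t) *\<^sub>R x + t *\<^sub>R y) - a))\<^sup>2
      \<le> (1 - t) * (norm (x - a))\<^sup>2 + t * (norm (y - a))\<^sup>2" by linarith
qed simp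

section \<open>Convex combinations of bounded length\<close>

text \<open>
  Caratheodory's theorem with the points listed by the fixed index set \<open>{1..DIM('a) + 1}\<close> and
  pulled back to the domain of \<open>F\<close>.
\<close>
lemma convex_hull_image_indexed_combination:
  fixes F :: "'b \<Rightarrow> 'a::euclidean_space"
  assumes "v \<in> convex hull (F ` Y)"
  shows "\<exists>(m :: nat \<Rightarrow> real) yy. (\<forall>i\<in>{1..DIM('a) + 1}. 0 \<le> m i \<and> yy i \<in> Y)
    \<and> sum m {1..DIM('a) + 1} = 1 \<and> (\<Sum>i=1..DIM('a) + 1. m i *\<^sub>R F (yy i)) = v"
proof -
  obtain T where T: "finite T" "T \<subseteq> F ` Y" "card T \<le> DIM('a) + 1" "v \<in> convex hull T"
    using assms unfolding caratheodory[of "F ` Y"] by blast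
  obtain c where c: "\<forall>x\<in>T. 0 \<le> c x" "sum c T = 1" "(\<Sum>x\<in>T. c x *\<^sub>R x) = v"
    using T by (auto simp: convex_hull_finite)
  obtain h where h: "bij_betw h {1..card T} T" using ex_bij_betw_nat_finite_1[OF T(1)] by blast
  have "T \<noteq> {}" using T(4) by auto
  then obtain y0 where y0: "y0 \<in> Y" using T(2) by auto
  obtain s where s: "\<And>x. x \<in> T \<Longrightarrow> s x \<in> Y \<and> F (s x) = x" using T(2) by (metis image_iff subsetD)
  \<comment> \<open>If fewer than \<open>DIM('a) + 1\<close> points are needed, the list is padded with an arbitrary point
    of \<open>Y\<close> carrying weight zero.\<close>
  define m where "m i = (if i \<le> card T then c (h i) else 0)" for i
  define yy where "yy i = (if i \<le> card T then s (h i) else y0)" for i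
  have hT: "h i \<in> T" if "1 \<le> i" "i \<le> card T" for i using h that by (auto simp: bij_betw_def)
  have sub: "{1..card T} \<subseteq> {1..DIM('a) + 1}" using T(3) by auto
  have "(\<Sum>i=1..DIM('a) + 1. m i *\<^sub>R F (yy i)) = (\<Sum>i=1..card T. c (h i) *\<^sub>R h i)"
    using sub hT s by (intro sum.mono_neutral_cong_right) (auto simp: m_def yy_def)
  also have "\<dots> = v" using sum.reindex_bij_betw[OF h, of "\<lambda>x. c x *\<^sub>R x"] c by simp
  finally have v: "(\<Sum>i=1..DIM('a) + 1. m i *\<^sub>R F (yy i)) = v" .
  have "sum m {1..DIM('a) + 1} = (\<Sum>i=1..card T. c (h i))"
    using sub by (intro sum.mono_neutral_cong_right) (auto simp: m_def)
  also have "\<dots> = 1" using sum.reindex_bij_betw[OF h, of c] c by simp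
  finally have "sum m {1..DIM('a) + 1} = 1" .
  moreover have "\<forall>i\<in>{1..DIM('a) + 1}. 0 \<le> m i \<and> yy i \<in> Y"
    using c hT s y0 by (auto simp: m_def yy_def)
  ultimately show ?thesis using v by blast
qed

section \<open>The dual gap function of a continuous map on a compact set\<close>

locale compact_vi =
  fixes C :: "'a::euclidean_space set" and F :: "'a \<Rightarrow> 'a"
  assumes compact_C: "compact C" and C_nonempty: "C \<noteq> {}"
    and cont_F: "continuous_on UNIV F"
begin

text \<open>
  The real-valued form of the dual gap function. The supremum is attained, so the two agree
  (\<open>dual_gap_eq\<close>), and the analysis can be done over the reals.
\<close>
definition gap :: "'a \<Rightarrow> real" where
  "gap x = (SUP y\<in>C. F y \<bullet> (x - y))"

lemma tendsto_F: "(g \<longlongrightarrow> l) A \<Longrightarrow> ((\<lambda>i. F (g i)) \<longlongrightarrow> F l) A"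
  using cont_F by (simp add: continuous_on_eq_continuous_at isCont_tendsto_compose)

lemma gap_maximizer_exists:
  obtains y where "y \<in> C" "\<And>y'. y' \<in> C \<Longrightarrow> F y' \<bullet> (x - y') \<le> F y \<bullet> (x - y)"
proof -
  have "continuous_on C (\<lambda>y. F y \<bullet> (x - y))"
    by (intro continuous_intros continuous_on_subset[OF cont_F]) auto
  from continuous_attains_sup[OF compact_C C_nonempty this] show thesis
    using that by blast
qed

lemma gap_upper: "y \<in> C \<Longrightarrow> F y \<bullet> (x - y) \<le> gap x"
  unfolding gap_def by (rule gap_maximizer_exists[of x]) (auto intro!: cSUP_upper bdd_aboveI2)

lemma gap_attained:
  obtains y where "y \<in> C" "gap x = F y \<bullet> (x - y)"
proof -
  obtain y where y: "y \<in> C" "\<And>y'. y' \<in> C \<Longrightarrow> F y' \<bullet> (x - y') \<le> F y \<bullet> (x - y)"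
    using gap_maximizer_exists[of x] by blast
  then have "gap x \<le> F y \<bullet> (x - y)"
    unfolding gap_def by (intro cSUP_least) auto
  then show thesis using that y(1) gap_upper[OF y(1), of x] by force
qed

lemma dual_gap_eq: "dual_gap F C x = ereal (gap x)"
proof (rule antisym)
  show "dual_gap F C x \<le> ereal (gap x)"
    unfolding dual_gap_def by (auto intro!: SUP_least gap_upper)
  show "ereal (gap x) \<le> dual_gap F C x"
    unfolding dual_gap_def by (rule gap_attained[of x]) (auto intro: SUP_upper2)
qed

lemma dual_gap_argmax_iff: "y \<in> dual_gap_argmax F C x \<longleftrightarrow> y \<in> C \<and> gap x = F y \<bullet> (x - y)"
  by (simp add: dual_gap_argmax_def dual_gap_eq)

lemma gap_nonneg: "x \<in> C \<Longrightarrow> 0 \<le> gap x"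
  using gap_upper[of x x] by simp

lemma gap_subgradient:
  assumes "y \<in> dual_gap_argmax F C x"
  shows "gap x + F y \<bullet> (x' - x) \<le> gap x'"
  using assms gap_upper[of y x'] by (simp add: dual_gap_argmax_iff algebra_simps)

lemma gap_subgradient_convex_hull:
  assumes "v \<in> convex hull (F ` dual_gap_argmax F C x)"
  shows "gap x + v \<bullet> (x' - x) \<le> gap x'"
proof -
  have "convex hull (F ` dual_gap_argmax F C x) \<subseteq> {v. (x' - x) \<bullet> v \<le> gap x' - gap x}"
  proof (rule hull_minimal)
    show "F ` dual_gap_argmax F C x \<subseteq> {v. (x' - x) \<bullet> v \<le> gap x' - gap x}"
      using gap_subgradient[of _ x x'] by (fastforce simp: inner_commute)
  qed (rule convex_halfspace_le)
  then show ?thesis using assms by (auto simp: inner_commute)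
qed

lemma convex_gap: "convex_on UNIV gap"
proof (rule convex_onI)
  fix t :: real and x y :: 'a
  assume t: "0 < t" "t < 1"
  let ?z = "(1 - t) *\<^sub>R x + t *\<^sub>R y"
  obtain c where c: "c \<in> C" "gap ?z = F c \<bullet> (?z - c)" using gap_attained[of ?z] .
  then have "gap ?z = (1 - t) * (F c \<bullet> (x - c)) + t * (F c \<bullet> (y - c))"
    by (simp add: algebra_simps)
  also have "\<dots> \<le> (1 - t) * gap x + t * gap y"
    using t c(1) by (intro add_mono mult_left_mono gap_upper) auto
  finally show "gap ?z \<le> (1 - t) * gap x + t * gap y" .
qed simp

lemma tendsto_gap: "(g \<longlongrightarrow> l) A \<Longrightarrow> ((\<lambda>i. gap (g i)) \<longlongrightarrow> gap l) A"
  using convex_on_continuous[OF open_UNIV convex_gap]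
  by (simp add: continuous_on_eq_continuous_at isCont_tendsto_compose)

lemma dual_gap_argmax_closed_graph:
  assumes "\<And>n. y n \<in> dual_gap_argmax F C (x n)" "x \<longlonglongrightarrow> x'" "y \<longlonglongrightarrow> y'"
  shows "y' \<in> dual_gap_argmax F C x'"
proof -
  have "y' \<in> C"
    using assms compact_imp_closed[OF compact_C]
    by (auto simp: dual_gap_argmax_iff intro: closed_sequentially)
  moreover have "(\<lambda>n. gap (x n)) \<longlonglongrightarrow> F y' \<bullet> (x' - y')"
    using assms(1) by (simp add: dual_gap_argmax_iff)
       (intro tendsto_intros tendsto_F assms)
  then have "gap x' = F y' \<bullet> (x' - y')"
    using tendsto_gap[OF assms(2)] LIMSEQ_unique by blast
  ultimately show ?thesis by (simp add: dual_gap_argmax_iff)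
qed

lemma compact_dual_gap_argmax: "compact (dual_gap_argmax F C x)"
proof -
  have "closed (dual_gap_argmax F C x)"
    unfolding closed_sequential_limits
    by (blast intro: dual_gap_argmax_closed_graph[where x = "\<lambda>_. x"] tendsto_const)
  moreover have "dual_gap_argmax F C x = C \<inter> dual_gap_argmax F C x"
    by (auto simp: dual_gap_argmax_iff)
  ultimately show ?thesis using compact_C by (metis compact_Int_closed)
qed

text \<open>
  Danskin's formula, in the form of an inclusion for \<open>\<partial>(c g)(z)\<close>. The quadratic term is harmless
  to first order; allowing it lets the proximal term of the penalized problem be absorbed here.
  If \<open>q\<close> were not in the scaled hull, a direction \<open>d\<close> would separate it strictly. Maximizers at
  the points \<open>z - t d\<close> accumulate, as \<open>t\<close> decreases to \<open>0\<close>, at a maximizer \<open>y'\<close> for \<open>z\<close>, and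
  comparing difference quotients gives \<open>c F(y') \<bullet> d \<le> q \<bullet> d\<close>, against the separation.
\<close>
theorem proximal_subgradient_in_convex_hull:
  assumes prox: "\<And>x. c * gap z + q \<bullet> (x - z) \<le> c * gap x + b * (norm (x - z))\<^sup>2"
    and c: "0 \<le> c"
  obtains v where "v \<in> convex hull (F ` dual_gap_argmax F C z)" "q = c *\<^sub>R v"
proof -
  let ?Y = "dual_gap_argmax F C z"
  let ?K = "(\<lambda>v. c *\<^sub>R v) ` (convex hull (F ` ?Y))"
  have "q \<in> ?K"
  proof (rule ccontr)
    assume "q \<notin> ?K"
    moreover have "compact (F ` ?Y)"
      using compact_dual_gap_argmax cont_F
      by (intro compact_continuous_image continuous_on_subset[OF cont_F]) auto
    then have "closed ?K"
      by (intro compact_imp_closed compact_scaling compact_convex_hull)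
    ultimately obtain d \<beta> where d: "d \<bullet> q < \<beta>" "\<And>v. v \<in> ?K \<Longrightarrow> \<beta> < d \<bullet> v"
      using separating_hyperplane_closed_point[of ?K q] convex_scaling[OF convex_convex_hull]
      by blast
    define t where "t n = 1 / real (Suc n)" for n
    have t: "t n > 0" for n by (simp add: t_def)
    have t0: "t \<longlonglongrightarrow> 0" unfolding t_def by (rule LIMSEQ_Suc[OF lim_1_over_n])
    have "\<exists>y. y \<in> dual_gap_argmax F C (z - t n *\<^sub>R d)" for n
      by (rule gap_attained[of "z - t n *\<^sub>R d"]) (auto simp: dual_gap_argmax_iff)
    then obtain y where y: "\<And>n. y n \<in> dual_gap_argmax F C (z - t n *\<^sub>R d)" by metis
    then have "\<forall>n. y n \<in> C" by (simp add: dual_gap_argmax_iff)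
    then obtain y' r where r: "strict_mono (r :: nat \<Rightarrow> nat)" "(y \<circ> r) \<longlonglongrightarrow> y'"
      using compact_C unfolding compact_def by blast
    have tr: "(\<lambda>n. t (r n)) \<longlonglongrightarrow> 0" using LIMSEQ_subseq_LIMSEQ[OF t0 r(1)] by (simp add: o_def)
    have "(\<lambda>n. z - t (r n) *\<^sub>R d) \<longlonglongrightarrow> z - 0 *\<^sub>R d" by (intro tendsto_intros tr)
    then have y': "y' \<in> ?Y"
      using dual_gap_argmax_closed_graph[of "y \<circ> r" "\<lambda>n. z - t (r n) *\<^sub>R d"] y r(2) by simp
    have step: "c * (F (y n) \<bullet> d) \<le> d \<bullet> q + t n * (b * (norm d)\<^sup>2)" for n
    proof -
      have "gap (z - t n *\<^sub>R d) + F (y n) \<bullet> (t n *\<^sub>R d) \<le> gap z"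
        using gap_subgradient[OF y[of n], of z] by simp
      from mult_left_mono[OF this c]
      have "c * gap (z - t n *\<^sub>R d) + t n * (c * (F (y n) \<bullet> d)) \<le> c * gap z"
        by (simp add: algebra_simps)
      moreover have "c * gap z - t n * (d \<bullet> q) \<le> c * gap (z - t n *\<^sub>R d) + t n * (t n * (b * (norm d)\<^sup>2))"
        using prox[of "z - t n *\<^sub>R d"]
        by (simp add: inner_commute power_mult_distrib power2_eq_square algebra_simps)
      ultimately have "t n * (c * (F (y n) \<bullet> d)) \<le> t n * (d \<bullet> q + t n * (b * (norm d)\<^sup>2))"
        by (simp add: distrib_left)
      then show ?thesis using t[of n] by simp
    qed
    have "c * (F y' \<bullet> d) \<le> d \<bullet> q + 0 * (b * (norm d)\<^sup>2)"
    proof (rule LIMSEQ_le)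
      show "(\<lambda>n. c * (F (y (r n)) \<bullet> d)) \<longlonglongrightarrow> c * (F y' \<bullet> d)"
        using r(2) by (intro tendsto_intros tendsto_F) (simp add: o_def)
      show "(\<lambda>n. d \<bullet> q + t (r n) * (b * (norm d)\<^sup>2)) \<longlonglongrightarrow> d \<bullet> q + 0 * (b * (norm d)\<^sup>2)"
        by (intro tendsto_intros tr)
    qed (use step in auto)
    moreover have "\<beta> < d \<bullet> (c *\<^sub>R F y')"
      using y' by (intro d(2) imageI hull_inc) auto
    ultimately show False using d(1) by (simp add: inner_commute)
  qed
  then show thesis using that by blast
qed

end

section \<open>Monotone variational inequalities and penalization\<close>

locale monotone_vi = compact_vi +
  assumes mono: "vi_monotone F" and convex_C: "convex C"
begin

text \<open>
  Minty's lemma. Monotonicity moves the argument of \<open>F\<close> from the solution to the test point;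
  continuity and convexity of \<open>C\<close> move it back, by testing along the segment from \<open>z\<close> to \<open>y\<close>
  and letting the test point tend to \<open>z\<close>.
\<close>
theorem solution_iff_gap_nonpos: "z \<in> vi_solutions F C \<longleftrightarrow> z \<in> C \<and> gap z \<le> 0"
proof (intro iffI conjI)
  assume z: "z \<in> vi_solutions F C"
  then show "z \<in> C" by (simp add: vi_solutions_def)
  obtain y where y: "y \<in> C" "gap z = F y \<bullet> (z - y)" using gap_attained[of z] .
  have "0 \<le> (F y - F z) \<bullet> (y - z)" using mono by (simp add: vi_monotone_def)
  moreover have "0 \<le> F z \<bullet> (y - z)" using z y by (simp add: vi_solutions_def)
  ultimately show "gap z \<le> 0" using y(2) by (simp add: algebra_simps)
next
  assume z: "z \<in> C \<and> gap z \<le> 0"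
  have "0 \<le> F z \<bullet> (y - z)" if y: "y \<in> C" for y
  proof (rule tendsto_lowerbound)
    let ?p = "\<lambda>t. z + t *\<^sub>R (y - z)"
    have "(?p \<longlongrightarrow> z + 0 *\<^sub>R (y - z)) (at_right 0)" by (intro tendsto_intros)
    then show "((\<lambda>t. F (?p t) \<bullet> (y - z)) \<longlongrightarrow> F z \<bullet> (y - z)) (at_right 0)"
      by (intro tendsto_intros tendsto_F) simp
    have "0 \<le> F (?p t) \<bullet> (y - z)" if t: "0 < t" "t < 1" for t
    proof -
      have "?p t \<in> C"
        using convexD_alt[OF convex_C, of z y t] z y t by (simp add: algebra_simps)
      then have "F (?p t) \<bullet> (z - ?p t) \<le> 0" using gap_upper[of "?p t" z] z by linarith
      then have "0 \<le> t * (F (?p t) \<bullet> (y - z))" by simp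
      then show ?thesis using t by (simp add: zero_le_mult_iff)
    qed
    then show "eventually (\<lambda>t. 0 \<le> F (?p t) \<bullet> (y - z)) (at_right 0)"
      by (intro eventually_at_rightI[of 0 1]) auto
  qed simp
  then show "z \<in> vi_solutions F C" using z by (simp add: vi_solutions_def)
qed

lemma convex_solutions: "convex (vi_solutions F C)"
proof (rule convexI)
  fix x y and u v :: real
  assume *: "x \<in> vi_solutions F C" "y \<in> vi_solutions F C" "0 \<le> u" "0 \<le> v" "u + v = 1"
  have "gap (u *\<^sub>R x + v *\<^sub>R y) \<le> u * gap x + v * gap y"
    using convex_gap * by (simp add: convex_on_def)
  moreover have "u * gap x \<le> 0" "v * gap y \<le> 0"
    using * by (simp_all add: solution_iff_gap_nonpos mult_nonneg_nonpos)
  moreover have "u *\<^sub>R x + v *\<^sub>R y \<in> C"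
    using * convex_C by (simp add: solution_iff_gap_nonpos convexD)
  ultimately show "u *\<^sub>R x + v *\<^sub>R y \<in> vi_solutions F C"
    by (simp add: solution_iff_gap_nonpos)
qed

lemma gap_solution: "z \<in> vi_solutions F C \<Longrightarrow> gap z = 0"
  using gap_nonneg[of z] by (force simp: solution_iff_gap_nonpos)

text \<open>
  The exact optimality system of one penalized problem. The last conclusion compares the optimal
  value with the value at \<open>xbar\<close>, where both the gap and the proximal term vanish.
\<close>
lemma penalized_minimizer:
  assumes xbar: "xbar \<in> vi_solutions F C" and c: "0 \<le> c"
  obtains z v w where "z \<in> C" "w \<in> normal_cone C z"
    "v \<in> convex hull (F ` dual_gap_argmax F C z)"
    "u + c *\<^sub>R v + w = xbar - z"
    "u \<bullet> z + c * gap z + (norm (z - xbar))\<^sup>2 / 2 \<le> u \<bullet> xbar"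
proof -
  define h where "h x = u \<bullet> x + c * gap x + (1/2) * (norm (x - xbar))\<^sup>2" for x
  have xC: "xbar \<in> C" using xbar by (simp add: vi_solutions_def)
  have lin: "convex_on UNIV (\<lambda>x. u \<bullet> x)" by (rule convex_onI) (auto simp: algebra_simps)
  have convex_h: "convex_on UNIV h"
    unfolding h_def using c
    by (intro convex_on_add convex_on_cmul convex_gap convex_on_norm_diff_squared lin) auto
  then have "continuous_on C h"
    using convex_on_continuous[OF open_UNIV] continuous_on_subset by blast
  then obtain z where z: "z \<in> C" "\<And>x. x \<in> C \<Longrightarrow> h z \<le> h x"
    using continuous_attains_inf[OF compact_C C_nonempty, of h] by blast
  obtain p where p: "p \<in> subdifferential h z" "- p \<in> normal_cone C z"
    using constrained_minimizer_multiplier[OF convex_h convex_C z] by blast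
  \<comment> \<open>The linear part and the derivative of the proximal term are subtracted from the
    subgradient \<open>p\<close>; the remainder belongs to the gap function.\<close>
  let ?q = "p - u - (z - xbar)"
  have "c * gap z + ?q \<bullet> (x - z) \<le> c * gap x + (1/2) * (norm (x - z))\<^sup>2" for x
  proof -
    have "(norm (x - xbar))\<^sup>2 = (norm (x - z))\<^sup>2 + 2 * ((z - xbar) \<bullet> (x - z)) + (norm (z - xbar))\<^sup>2"
      by (simp add: power2_norm_eq_inner algebra_simps inner_commute)
    moreover have "h z + p \<bullet> (x - z) \<le> h x" using p(1) by (simp add: subdifferential_def)
    ultimately show ?thesis
      unfolding h_def inner_diff_left inner_diff_right by argo
  qed
  from proximal_subgradient_in_convex_hull[OF this c]
  obtain v where v: "v \<in> convex hull (F ` dual_gap_argmax F C z)" "?q = c *\<^sub>R v" by blast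
  show thesis
  proof
    show "u + c *\<^sub>R v + - p = xbar - z" using v(2) by (simp add: algebra_simps flip: v(2))
    show "u \<bullet> z + c * gap z + (norm (z - xbar))\<^sup>2 / 2 \<le> u \<bullet> xbar"
      using z(2)[OF xC] by (simp add: h_def gap_solution[OF xbar])
  qed (use z p v in auto)
qed

text \<open>
  The penalty weights are \<open>k + 1\<close>, restricted to a subsequence along which the penalized
  minimizers converge. The same points \<open>z\<close> serve for the gap subgradients and for the normals.
\<close>
theorem sequential_multipliers:
  assumes xbar: "xbar \<in> vi_solutions F C" and u: "- u \<in> normal_cone (vi_solutions F C) xbar"
  obtains c z v w where
    "\<And>k. 0 \<le> c k" "\<And>k. z k \<in> C" "\<And>k. w k \<in> normal_cone C (z k)"
    "\<And>k. v k \<in> convex hull (F ` dual_gap_argmax F C (z k))"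
    "(\<lambda>k. u + c k *\<^sub>R v k + w k) \<longlonglongrightarrow> 0" "z \<longlonglongrightarrow> xbar"
    "(\<lambda>k. c k * gap (z k) - (c k *\<^sub>R v k) \<bullet> (z k - xbar)) \<longlonglongrightarrow> 0"
    "(\<lambda>k. w k \<bullet> (z k - xbar)) \<longlonglongrightarrow> (0::real)"
proof -
  have "\<exists>z v w. z \<in> C \<and> w \<in> normal_cone C z \<and> v \<in> convex hull (F ` dual_gap_argmax F C z)
    \<and> u + real (Suc k) *\<^sub>R v + w = xbar - z
    \<and> u \<bullet> z + real (Suc k) * gap z + (norm (z - xbar))\<^sup>2 / 2 \<le> u \<bullet> xbar" for k
    by (rule penalized_minimizer[OF xbar, of "real (Suc k)" u]) auto
  then obtain z v w where z: "\<And>k. z k \<in> C" and w: "\<And>k. w k \<in> normal_cone C (z k)"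
    and v: "\<And>k. v k \<in> convex hull (F ` dual_gap_argmax F C (z k))"
    and eq: "\<And>k. u + real (Suc k) *\<^sub>R v k + w k = xbar - z k"
    and val: "\<And>k. u \<bullet> z k + real (Suc k) * gap (z k) + (norm (z k - xbar))\<^sup>2 / 2 \<le> u \<bullet> xbar"
    by metis
  obtain l r where l: "l \<in> C" and r: "strict_mono (r :: nat \<Rightarrow> nat)" and "(z \<circ> r) \<longlonglongrightarrow> l"
    using compact_C z unfolding compact_def by metis
  then have zl: "(\<lambda>k. z (r k)) \<longlonglongrightarrow> l" by (simp add: o_def)
  define c where "c k = real (Suc (r k))" for k
  have c: "0 < c k" for k by (simp add: c_def)
  have gap_bound: "c k * gap (z (r k)) \<le> u \<bullet> (xbar - z (r k))" for k
    using val[of "r k"] zero_le_power2[of "norm (z (r k) - xbar)"]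
    unfolding c_def inner_diff_right by linarith
  have "(\<lambda>k. inverse (real (Suc k))) \<longlonglongrightarrow> 0" by (rule LIMSEQ_inverse_real_of_nat)
  then have inv: "(\<lambda>k. inverse (c k)) \<longlonglongrightarrow> 0"
    using LIMSEQ_subseq_LIMSEQ[OF _ r, of "\<lambda>k. inverse (real (Suc k))"] by (simp add: c_def o_def)
  \<comment> \<open>The penalty weight grows while the bound on the penalty term stays bounded.\<close>
  have "gap l \<le> 0 * (u \<bullet> (xbar - l))"
  proof (rule LIMSEQ_le)
    show "(\<lambda>k. gap (z (r k))) \<longlonglongrightarrow> gap l" by (rule tendsto_gap[OF zl])
    show "(\<lambda>k. inverse (c k) * (u \<bullet> (xbar - z (r k)))) \<longlonglongrightarrow> 0 * (u \<bullet> (xbar - l))"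
      by (intro tendsto_intros inv zl)
    show "\<exists>N. \<forall>n\<ge>N. gap (z (r n)) \<le> inverse (c n) * (u \<bullet> (xbar - z (r n)))"
      using gap_bound c by (simp add: field_simps)
  qed
  then have "l \<in> vi_solutions F C" using l by (simp add: solution_iff_gap_nonpos)
  then have "0 \<le> u \<bullet> (l - xbar)" using u by (force simp: normal_cone_def)
  moreover have "(norm (l - xbar))\<^sup>2 / 2 \<le> u \<bullet> (xbar - l)"
  proof (rule LIMSEQ_le)
    show "(\<lambda>k. (norm (z (r k) - xbar))\<^sup>2 / 2) \<longlonglongrightarrow> (norm (l - xbar))\<^sup>2 / 2"
      by (intro tendsto_intros zl) simp
    show "(\<lambda>k. u \<bullet> (xbar - z (r k))) \<longlonglongrightarrow> u \<bullet> (xbar - l)"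
      by (intro tendsto_intros zl)
    have "(norm (z k - xbar))\<^sup>2 / 2 \<le> u \<bullet> (xbar - z k)" for k
      using val[of k] mult_nonneg_nonneg[OF of_nat_0_le_iff gap_nonneg[OF z[of k]], of "Suc k"]
      unfolding inner_diff_right by linarith
    then show "\<exists>N. \<forall>n\<ge>N. (norm (z (r n) - xbar))\<^sup>2 / 2 \<le> u \<bullet> (xbar - z (r n))" by blast
  qed
  ultimately have "(norm (l - xbar))\<^sup>2 \<le> 0"
    unfolding inner_diff_right by linarith
  then have "l = xbar" by simp
  then have zx: "(\<lambda>k. z (r k)) \<longlonglongrightarrow> xbar" using zl by simp
  have diff0: "(\<lambda>k. z (r k) - xbar) \<longlonglongrightarrow> 0" using zx by (simp add: LIM_zero)
  have eqr: "u + c k *\<^sub>R v (r k) + w (r k) = xbar - z (r k)" for k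
    using eq[of "r k"] by (simp add: c_def)
  \<comment> \<open>The complementarity errors \<open>?e\<close> and \<open>?n\<close> and the penalty term are nonnegative. Their sum
    is \<open>?s\<close>, by pairing the stationarity equation with \<open>z - xbar\<close>, and \<open>?s\<close> tends to \<open>0\<close>
    since its left factor is bounded.\<close>
  let ?e = "\<lambda>k. (c k *\<^sub>R v (r k)) \<bullet> (z (r k) - xbar) - c k * gap (z (r k))"
  let ?n = "\<lambda>k. w (r k) \<bullet> (z (r k) - xbar)"
  let ?s = "\<lambda>k. (xbar - z (r k) - u) \<bullet> (z (r k) - xbar)"
  have e: "0 \<le> ?e k" for k
  proof -
    have "gap (z (r k)) + v (r k) \<bullet> (xbar - z (r k)) \<le> gap xbar"
      by (rule gap_subgradient_convex_hull[OF v])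
    then have "0 \<le> v (r k) \<bullet> (z (r k) - xbar) - gap (z (r k))"
      by (simp add: gap_solution[OF xbar] inner_diff_right)
    from mult_nonneg_nonneg[OF less_imp_le[OF c[of k]] this]
    show ?thesis by (simp add: right_diff_distrib)
  qed
  have n: "0 \<le> ?n k" for k
    using w[of "r k"] xbar by (force simp: normal_cone_def vi_solutions_def inner_diff_right)
  have g: "0 \<le> c k * gap (z (r k))" for k
    using c[of k] gap_nonneg[OF z] by simp
  have sum: "?e k + c k * gap (z (r k)) + ?n k = ?s k" for k
  proof -
    have "c k *\<^sub>R v (r k) + w (r k) = xbar - z (r k) - u" using eqr[of k] by (simp add: algebra_simps)
    then have "(c k *\<^sub>R v (r k)) \<bullet> (z (r k) - xbar) + ?n k = ?s k"
      by (metis inner_add_left)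
    then show ?thesis by simp
  qed
  have "?s \<longlonglongrightarrow> (xbar - xbar - u) \<bullet> 0" by (intro tendsto_intros zx diff0)
  then have s: "?s \<longlonglongrightarrow> 0" by simp
  have e0: "?e \<longlonglongrightarrow> 0"
  proof (rule tendsto_sandwich[OF _ _ tendsto_const s])
    show "eventually (\<lambda>k. ?e k \<le> ?s k) sequentially"
      by (rule always_eventually) (use sum n g in smt)
  qed (use e in auto)
  have n0: "?n \<longlonglongrightarrow> 0"
  proof (rule tendsto_sandwich[OF _ _ tendsto_const s])
    show "eventually (\<lambda>k. ?n k \<le> ?s k) sequentially"
      by (rule always_eventually) (use sum e g in smt)
  qed (use n in auto)
  show thesis
  proof (rule that[of c "\<lambda>k. z (r k)" "\<lambda>k. w (r k)" "\<lambda>k. v (r k)"])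
    show "(\<lambda>k. u + c k *\<^sub>R v (r k) + w (r k)) \<longlonglongrightarrow> 0"
      unfolding eqr using tendsto_minus[OF diff0] by simp
    show "(\<lambda>k. c k * gap (z (r k)) - (c k *\<^sub>R v (r k)) \<bullet> (z (r k) - xbar)) \<longlonglongrightarrow> 0"
      using tendsto_minus[OF e0] by simp
  qed (use less_imp_le[OF c] z w v zx n0 in auto)
qed

text \<open>
  Up to the three error terms, which vanish in the limit, \<open>u \<bullet> (z - xbar)\<close> equals
  \<open>- c k * (gap (x k) + v k \<bullet> (z - x k)) - w k \<bullet> (z - y k)\<close>. Both summands are nonnegative: the
  first because the affine minorant of the gap at \<open>x k\<close> is at most \<open>gap z = 0\<close>, the second because
  \<open>w k\<close> is a normal.
\<close>
theorem sequential_multipliers_imp_variational: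
  assumes z: "z \<in> vi_solutions F C"
    and c: "\<And>k. 0 \<le> c k" and w: "\<And>k. w k \<in> normal_cone C (y k)"
    and v: "\<And>k. gap (x k) + v k \<bullet> (z - x k) \<le> gap z"
    and lim: "(\<lambda>k. u + c k *\<^sub>R v k + w k) \<longlonglongrightarrow> 0"
    and lim_g: "(\<lambda>k. c k * gap (x k) - (c k *\<^sub>R v k) \<bullet> (x k - xbar)) \<longlonglongrightarrow> 0"
    and lim_w: "(\<lambda>k. w k \<bullet> (y k - xbar)) \<longlonglongrightarrow> 0"
  shows "0 \<le> u \<bullet> (z - xbar)"
proof (rule LIMSEQ_le_const)
  let ?b = "\<lambda>k. u \<bullet> (z - xbar) - (u + c k *\<^sub>R v k + w k) \<bullet> (z - xbar)
    - (c k * gap (x k) - (c k *\<^sub>R v k) \<bullet> (x k - xbar)) + w k \<bullet> (y k - xbar)"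
  have "?b \<longlonglongrightarrow> u \<bullet> (z - xbar) - 0 \<bullet> (z - xbar) - 0 + 0"
    by (intro tendsto_intros lim lim_g lim_w)
  then show "?b \<longlonglongrightarrow> u \<bullet> (z - xbar)" by simp
  have "0 \<le> ?b k" for k
  proof -
    have "?b k = - (c k * (gap (x k) + v k \<bullet> (z - x k))) - w k \<bullet> (z - y k)"
      by (simp add: algebra_simps)
    moreover have "c k * (gap (x k) + v k \<bullet> (z - x k)) \<le> c k * 0"
      using v[of k] gap_solution[OF z] by (intro mult_left_mono c) simp
    moreover have "w k \<bullet> (z - y k) \<le> 0"
      using w[of k] z by (simp add: normal_cone_def vi_solutions_def)
    ultimately show ?thesis by simp
  qed
  then show "\<exists>N. \<forall>n\<ge>N. 0 \<le> ?b n" by blast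
qed

end

theorem theorem4p1:
  fixes C :: "(real ^ 'n) set"
    and F :: "real ^ 'n \<Rightarrow> real ^ 'n"
    and f :: "real ^ 'n \<Rightarrow> real"
    and xbar :: "real ^ 'n"
  assumes "compact C" and "convex C"
    and "vi_monotone F" and "continuous_on UNIV F"
    and "convex_on UNIV f"
    and "vi_solutions F C \<noteq> {}"
    and "xbar \<in> vi_solutions F C"
  shows "smpec_solution f F C xbar \<longleftrightarrow>
    (\<exists>u \<in> subdifferential f xbar.
     \<exists>(lam :: nat \<Rightarrow> real) (x :: nat \<Rightarrow> real ^ 'n) (y :: nat \<Rightarrow> real ^ 'n) (w :: nat \<Rightarrow> real ^ 'n)
      (mu :: nat \<Rightarrow> nat \<Rightarrow> real) (yy :: nat \<Rightarrow> nat \<Rightarrow> real ^ 'n).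
        (\<forall>k. lam k \<ge> 0
           \<and> x k \<in> effective_domain (\<lambda>z. ereal (lam k) * dual_gap F C z)
           \<and> y k \<in> C
           \<and> w k \<in> normal_cone C (y k)
           \<and> (\<forall>i\<in>{1..CARD('n) + 1}. mu k i \<ge> 0 \<and> yy k i \<in> dual_gap_argmax F C (x k))
           \<and> (\<Sum>i=1..CARD('n) + 1. mu k i) = 1)
        \<and> (\<lambda>k. u + lam k *\<^sub>R (\<Sum>i=1..CARD('n) + 1. mu k i *\<^sub>R F (yy k i)) + w k)
            \<longlonglongrightarrow> 0
        \<and> x \<longlonglongrightarrow> xbar
        \<and> y \<longlonglongrightarrow> xbar
        \<and> (\<lambda>k. ereal (lam k) * dual_gap F C (x k)
              - ereal ((lam k *\<^sub>R (\<Sum>i=1..CARD('n) + 1. mu k i *\<^sub>R F (yy k i))) \<bullet> (x k - xbar)))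
            \<longlonglongrightarrow> 0
        \<and> (\<lambda>k. w k \<bullet> (y k - xbar)) \<longlonglongrightarrow> 0)"
proof -
  have C: "C \<noteq> {}" using assms(6) by (auto simp: vi_solutions_def)
  interpret monotone_vi C F
    using assms C by unfold_locales auto
  have xbar: "xbar \<in> vi_solutions F C" by fact
  have min_iff: "smpec_solution f F C xbar \<longleftrightarrow> (\<forall>z \<in> vi_solutions F C. f xbar \<le> f z)"
    using xbar by (auto simp: smpec_solution_def is_arg_min_def not_less)
  let ?I = "{1..CARD('n) + 1}"
  show ?thesis (is "_ \<longleftrightarrow> (\<exists>u \<in> _. ?seq u)")
  proof
    assume "smpec_solution f F C xbar"
    then obtain u where u: "u \<in> subdifferential f xbar"
        "- u \<in> normal_cone (vi_solutions F C) xbar"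
      using constrained_minimizer_multiplier[OF assms(5) convex_solutions xbar] min_iff by blast
    obtain c z v w where seq: "\<And>k. 0 \<le> c k" "\<And>k. z k \<in> C" "\<And>k. w k \<in> normal_cone C (z k)"
      and v: "\<And>k. v k \<in> convex hull (F ` dual_gap_argmax F C (z k))"
      and lims: "(\<lambda>k. u + c k *\<^sub>R v k + w k) \<longlonglongrightarrow> 0" "z \<longlonglongrightarrow> xbar"
        "(\<lambda>k. c k * gap (z k) - (c k *\<^sub>R v k) \<bullet> (z k - xbar)) \<longlonglongrightarrow> 0"
        "(\<lambda>k. w k \<bullet> (z k - xbar)) \<longlonglongrightarrow> 0"
      by (rule sequential_multipliers[OF xbar u(2)]) (rule that)
    define rep where "rep k m yy \<longleftrightarrow> (\<forall>i\<in>?I. 0 \<le> m i \<and> yy i \<in> dual_gap_argmax F C (z k))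
        \<and> sum m ?I = (1::real) \<and> (\<Sum>i\<in>?I. m i *\<^sub>R F (yy i)) = v k" for k m yy
    have "\<exists>m yy. rep k m yy" for k
      using convex_hull_image_indexed_combination[OF v[of k]] by (simp add: rep_def)
    then obtain mu yy where "\<And>k. rep k (mu k) (yy k)" by metis
    then have mu: "\<And>k i. i \<in> ?I \<Longrightarrow> 0 \<le> mu k i \<and> yy k i \<in> dual_gap_argmax F C (z k)"
        "\<And>k. sum (mu k) ?I = 1" "\<And>k. (\<Sum>i\<in>?I. mu k i *\<^sub>R F (yy k i)) = v k"
      by (simp_all add: rep_def)
    have "?seq u"
      by (rule exI[of _ c], rule exI[of _ z], rule exI[of _ z], rule exI[of _ w],
          rule exI[of _ mu], rule exI[of _ yy])
         (use seq lims mu in \<open>simp add: dual_gap_eq effective_domain_def zero_ereal_def\<close>)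
    then show "\<exists>u \<in> subdifferential f xbar. ?seq u" using u(1) by blast
  next
    assume "\<exists>u \<in> subdifferential f xbar. ?seq u"
    then obtain u lam x y w mu yy where u: "u \<in> subdifferential f xbar"
      and seq: "\<And>k. 0 \<le> lam k" "\<And>k. w k \<in> normal_cone C (y k)"
        "\<And>k i. i \<in> ?I \<Longrightarrow> 0 \<le> mu k i \<and> yy k i \<in> dual_gap_argmax F C (x k)"
        "\<And>k. sum (mu k) ?I = (1::real)"
      and lims: "(\<lambda>k. u + lam k *\<^sub>R (\<Sum>i\<in>?I. mu k i *\<^sub>R F (yy k i)) + w k) \<longlonglongrightarrow> 0"
        "(\<lambda>k. ereal (lam k) * dual_gap F C (x k)
          - ereal ((lam k *\<^sub>R (\<Sum>i\<in>?I. mu k i *\<^sub>R F (yy k i))) \<bullet> (x k - xbar))) \<longlonglongrightarrow> 0"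
        "(\<lambda>k. w k \<bullet> (y k - xbar)) \<longlonglongrightarrow> 0"
      by (elim bexE exE conjE) (rule that; simp)
    have lim_g: "(\<lambda>k. lam k * gap (x k)
        - (lam k *\<^sub>R (\<Sum>i\<in>?I. mu k i *\<^sub>R F (yy k i))) \<bullet> (x k - xbar)) \<longlonglongrightarrow> 0"
      using lims(2) by (simp add: dual_gap_eq zero_ereal_def)
    have hull: "(\<Sum>i\<in>?I. mu k i *\<^sub>R F (yy k i)) \<in> convex hull (F ` dual_gap_argmax F C (x k))" for k
      using seq(3,4) by (intro convex_sum convex_convex_hull hull_inc imageI) auto
    show "smpec_solution f F C xbar"
      unfolding min_iff
    proof
      fix z assume z: "z \<in> vi_solutions F C"
      have "0 \<le> u \<bullet> (z - xbar)"
        by (rule sequential_multipliers_imp_variational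
            [OF z seq(1,2) gap_subgradient_convex_hull[OF hull] lims(1) lim_g lims(3)])
      moreover have "f xbar + u \<bullet> (z - xbar) \<le> f z" using u by (simp add: subdifferential_def)
      ultimately show "f xbar \<le> f z" by linarith
    qed
  qed
qed

end
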